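(* Let $\mathcal D=[0,1]^2$ be partitioned into disjoint sub-domains $\mathcal D_{1,0},\dots,\mathcal D_{k_0,0}$ (which, together with $k_0$, may vary with $n$), and suppose there are constants $c',C'>0$ such that for all $1\le l\le k_0$: $c'k_0^{-1}\le|\mathcal D_{l,0}|\le C'k_0^{-1}$; $c'\le|\partial\mathcal D_{l,0}|/|\mathcal D_{l,0}|^{1/2}\le C'$; $N(\partial\mathcal D_{l,0},\delta,\|\cdot\|_2)\le C'|\partial\mathcal D_{l,0}|\delta^{-1}$ for all $0<\delta<|\partial\mathcal D_{l,0}|$; and for any $\boldsymbol s,\boldsymbol s'\in\mathcal D_{l,0}$ there is a path $\mathcal P(\boldsymbol s,\boldsymbol s')$ contained in $\mathcal D_{l,0}$ connecting $\boldsymbol s$ and $\boldsymbol s'$ with $d\{\mathcal P(\boldsymbol s,\boldsymbol s'),\partial\mathcal D_{l,0}\}=\min\{d(\boldsymbol s,\partial\mathcal D_{l,0}),d(\boldsymbol s',\partial\mathcal D_{l,0})\}$ or $d\{\mathcal P(\boldsymbol s,\boldsymbol s'),\partial\mathcal D_{l,0}\}\ge C'$. Let $\Xi^*$ be the partition space and $\pi_0^*$ the reference partition of the context. Then there exists a constant $C>0$ such that $$\frac{|\{\mathcal T:\mathcal T\text{ can induce }\pi^*\}|}{|\{\mathcal T:\mathcal T\text{ can induce }\pi_0^*\}|}\le\exp\{Ck_0^{1/2}K\log(K)\}\times\binom{2(K-1)^2}{k-1}$$ holds for all $\pi^*\in\Xi^*$, where $k$ is the number of clusters in $\pi^*$.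
   Context: $K$ is a positive integer (a model hyperparameter, which may vary with the sample size $n$). $\mathcal D$ is split into $K^2$ disjoint square blocks $B_1,\dots,B_{K^2}$ of side length $K^{-1}$; $\mathcal G=(\mathcal V,\mathcal E)$ is the $K\times K$ mesh grid graph whose vertices are the blocks and whose edges connect adjacent blocks; $\mathcal T$ ranges over spanning trees of $\mathcal G$. A spanning tree $\mathcal T$ can induce a domain partition with $k$ clusters if, after deleting some $k-1$ edges of $\mathcal T$, the resulting $k$ connected components are the clusters of blocks, all points of a block being given the cluster of that block. The prior on partitions is: $\mathcal T$ uniform over spanning trees of $\mathcal G$; the number of clusters $k$ Poisson($\lambda$) restricted to $1\le k\le K^2$; and, given $\mathcal T$ and $k$, the partition uniform over those with $k$ clusters that $\mathcal T$ can induce. $\Xi^*$ is the set of domain partitions with positive probability under this prior. The reference partition $\pi_0^*=\{\mathcal D_{1,0}^*,\dots,\mathcal D_{k_0,0}^*\}$ is a contiguous partition in this model space with $\sum_{j=1}^{k_0}|\{B_m:B_m\subseteq\mathcal D_{j,0}^*,\ B_m\not\subseteq\mathcal D_{j,0}\}|\le c\,k_0^{1/2}K$ for some constant $c$ (the paper shows such a partition exists under the stated assumptions on the sub-domains). $|\cdot|$ is area for planar regions and cardinality for finite sets; $d(\cdot,\cdot)$ is Euclidean distance between points and infimum distance between sets; $N(\cdot,\delta,\|\cdot\|_2)$ is the $\delta$-covering number; $|\partial\mathcal D_{l,0}|=\lim_{\delta\to0}\delta N(\partial\mathcal D_{l,0},\delta,\|\cdot\|_2)$ is the length of the boundary. Constants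 do not depend on the partition $\pi^*$ and do not vary with $n$.
   Formalization: The case K = 2 with k = 4 clusters is excluded: there the binomial coefficient C(2,3) is 0 while the ratio of tree counts is positive, so the stated inequality fails (e.g. k_0 = 1, four single-block clusters). *)

theory Defs
  imports "HOL-Probability.Probability"
begin

definition unit_square :: "(real \<times> real) set" where
  "unit_square = {0..1} \<times> {0..1}"


(* Centres are arbitrary points of the ambient space. LEAST is meaningful for totally bounded S,
   in particular for the frontier of a subset of the unit square. *)
definition covering_number :: "(real \<times> real) set \<Rightarrow> real \<Rightarrow> nat" where
  "covering_number S \<delta> =
     (LEAST m. \<exists>P. finite P \<and> card P = m \<and> S \<subseteq> (\<Union>x\<in>P. cball x \<delta>))"

definition has_boundary_length :: "(real \<times> real) set \<Rightarrow> bool" where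
  "has_boundary_length S \<longleftrightarrow>
     (\<exists>L. ((\<lambda>\<delta>. \<delta> * real (covering_number (frontier S) \<delta>)) \<longlongrightarrow> L) (at_right 0))"

definition boundary_length :: "(real \<times> real) set \<Rightarrow> real" where
  "boundary_length S = Lim (at_right 0) (\<lambda>\<delta>. \<delta> * real (covering_number (frontier S) \<delta>))"


(* An undirected graph is a vertex set together with a set of two-element edges {u, v}.
   The AFP entry Graph_Theory is not used: there, a tree is a digraph without directed cycles whose
   underlying graph is connected, which differs from the undirected notion. *)

definition reachable_in :: "'v set set \<Rightarrow> 'v \<Rightarrow> 'v \<Rightarrow> bool" where
  "reachable_in E = (\<lambda>u v. {u, v} \<in> E)\<^sup>*\<^sup>*"

definition graph_connected :: "'v set \<Rightarrow> 'v set set \<Rightarrow> bool" where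
  "graph_connected V E \<longleftrightarrow> (\<forall>u\<in>V. \<forall>v\<in>V. reachable_in E u v)"

definition graph_cycle :: "'v set set \<Rightarrow> 'v list \<Rightarrow> bool" where
  "graph_cycle E p \<longleftrightarrow> 3 \<le> length p \<and> distinct p \<and>
     (\<forall>i<length p. {p ! i, p ! (Suc i mod length p)} \<in> E)"

definition spanning_trees :: "'v set \<Rightarrow> 'v set set \<Rightarrow> 'v set set set" where
  "spanning_trees V E =
     {T. T \<subseteq> E \<and> graph_connected V T \<and> \<not> (\<exists>p. graph_cycle T p)}"

definition graph_components :: "'v set \<Rightarrow> 'v set set \<Rightarrow> 'v set set" where
  "graph_components V E = V // {(u, v). u \<in> V \<and> v \<in> V \<and> reachable_in E u v}"


(* Blocks are half-open, except that those in the last row and column are closed at 1;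
   thus they are disjoint and cover the unit square. *)
definition block_side :: "nat \<Rightarrow> nat \<Rightarrow> real set" where
  "block_side K i = (if Suc i = K then {real i / real K..1}
                     else {real i / real K..<real (Suc i) / real K})"

definition block :: "nat \<Rightarrow> nat \<times> nat \<Rightarrow> (real \<times> real) set" where
  "block K v = block_side K (fst v) \<times> block_side K (snd v)"

(* The block with index (i, j) is represented as a vertex by its index; for positive K, block K is
   injective on mesh_verts K. *)
definition mesh_verts :: "nat \<Rightarrow> (nat \<times> nat) set" where
  "mesh_verts K = {..<K} \<times> {..<K}"

definition mesh_edges :: "nat \<Rightarrow> (nat \<times> nat) set set" where
  "mesh_edges K = {{(i, j), (Suc i, j)} | i j. Suc i < K \<and> j < K}
                \<union> {{(i, j), (i, Suc j)} | i j. i < K \<and> Suc j < K}"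

definition mesh_trees :: "nat \<Rightarrow> (nat \<times> nat) set set set" where
  "mesh_trees K = spanning_trees (mesh_verts K) (mesh_edges K)"

definition region :: "nat \<Rightarrow> (nat \<times> nat) set \<Rightarrow> (real \<times> real) set" where
  "region K S = (\<Union>v\<in>S. block K v)"

definition can_induce ::
    "nat \<Rightarrow> (nat \<times> nat) set set \<Rightarrow> (real \<times> real) set set \<Rightarrow> bool" where
  "can_induce K T \<pi> \<longleftrightarrow>
     (\<exists>F. F \<subseteq> T \<and> card F = card \<pi> - 1 \<and>
          \<pi> = region K ` graph_components (mesh_verts K) (T - F))"

definition partition_prior :: "real \<Rightarrow> nat \<Rightarrow> (real \<times> real) set set pmf" where
  "partition_prior lam K =
     bind_pmf (pmf_of_set (mesh_trees K)) (\<lambda>T.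
     bind_pmf (cond_pmf (poisson_pmf lam) {1..K\<^sup>2}) (\<lambda>k.
     pmf_of_set {\<pi>. card \<pi> = k \<and> can_induce K T \<pi>}))"

definition partition_space :: "real \<Rightarrow> nat \<Rightarrow> (real \<times> real) set set set" where
  "partition_space lam K = {\<pi>. pmf (partition_prior lam K) \<pi> > 0}"

end

theory Submission
  imports Defs
begin

text \<open>
  Let \<open>b\<close> be the number of mesh edges joining different clusters of the reference partition.
  An arbitrary spanning tree becomes one inducing the reference partition after an exchange of
  at most \<open>b\<close> edges: drop its cross edges, complete the rest to a spanning forest of the
  clusters, and complete that to a spanning tree. Since the original tree is recovered from the new one
  and the two sets of exchanged edges, there are at most \<open>(|E| + 1) ^ (2 * b)\<close> times as many
  spanning trees as trees inducing the reference partition. The binomial factor only needs to be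
  at least 1.

  Two adjacent blocks in different reference clusters either include one of the few misplaced blocks or
  have a corner on the frontier of some sub-domain, and a ball of radius \<open>1/K\<close> contains at most
  nine corners. Hence \<open>b\<close> is at most a constant times \<open>sqrt k0 * K\<close>.
\<close>

section \<open>Reachability and forests\<close>

lemma reachable_in_refl [simp]: "reachable_in E u u"
  by (simp add: reachable_in_def)

lemma reachable_in_sym: "reachable_in E u v \<Longrightarrow> reachable_in E v u"
  unfolding reachable_in_def
  by (rule sympD[OF symp_rtranclp]) (auto simp: symp_def insert_commute)

lemma reachable_in_trans: "reachable_in E u v \<Longrightarrow> reachable_in E v w \<Longrightarrow> reachable_in E u w"
  unfolding reachable_in_def by (rule rtranclp_trans)

lemma reachable_in_edge: "{u, v} \<in> E \<Longrightarrow> reachable_in E u v"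
  unfolding reachable_in_def by blast

text \<open>Reachability in \<open>F\<close> is reflexive and transitive, so it suffices that it
  contains the edges of \<open>E\<close>. Comparisons between edge sets are reduced to single edges
  this way.\<close>

lemma reachable_in_least:
  assumes "reachable_in E u v" and "\<And>x y. {x, y} \<in> E \<Longrightarrow> reachable_in F x y"
  shows "reachable_in F u v"
  using assms(1) unfolding reachable_in_def[of E]
  by (induction rule: rtranclp_induct) (auto intro: reachable_in_trans assms(2))

lemma reachable_in_mono: "reachable_in E u v \<Longrightarrow> E \<subseteq> F \<Longrightarrow> reachable_in F u v"
  by (erule reachable_in_least) (auto intro: reachable_in_edge)

text \<open>The cases record whether the new edge is crossed and in which direction; repeated
  crossings can be shortcut. Inserting an edge into a forest and merging two components both rest on
  this formula.\<close>

lemma reachable_in_insert: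
  "reachable_in (insert {u, v} E) x y \<longleftrightarrow>
     reachable_in E x y \<or> reachable_in E x u \<and> reachable_in E v y \<or>
     reachable_in E x v \<and> reachable_in E u y" (is "?L = ?R x y")
proof
  assume ?L
  then show "?R x y"
    unfolding reachable_in_def[of "insert {u, v} E"]
  proof (induction rule: rtranclp_induct)
    case base
    show ?case by simp
  next
    case (step y z)
    then consider "{y, z} \<in> E" | "y = u" "z = v" | "y = v" "z = u"
      by (auto simp: doubleton_eq_iff)
    then show ?case
    proof cases
      case 1
      then have "reachable_in E y z" by (rule reachable_in_edge)
      with step.IH show ?thesis by (meson reachable_in_trans)
    next
      case 2
      with step.IH show ?thesis
        using reachable_in_refl by (metis reachable_in_refl)
    next
      case 3
      with step.IH show ?thesis
        by (metis reachable_in_refl)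
    qed
  qed
next
  have "reachable_in (insert {u, v} E) u v" by (simp add: reachable_in_edge)
  moreover assume "?R x y"
  ultimately show ?L
    by (meson reachable_in_mono reachable_in_trans reachable_in_sym subset_insertI)
qed

text \<open>Acyclicity in the form "every edge is a bridge", which is easier to maintain under
  insertion and deletion of edges than a ban on cyclic vertex lists.\<close>

definition forest :: "'v set set \<Rightarrow> bool" where
  "forest E \<longleftrightarrow> (\<forall>u v. {u, v} \<in> E \<longrightarrow> \<not> reachable_in (E - {{u, v}}) u v)"

lemma forestD: "forest E \<Longrightarrow> {u, v} \<in> E \<Longrightarrow> \<not> reachable_in (E - {{u, v}}) u v"
  by (auto simp: forest_def)

lemma forest_subset: "forest E \<Longrightarrow> F \<subseteq> E \<Longrightarrow> forest F"
  unfolding forest_def by (meson Diff_mono order_refl reachable_in_mono subsetD)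

text \<open>If an old edge stopped being a bridge, the detour around it would cross the new edge;
  the rest of that detour and the old edge would then already join \<open>u\<close> and
  \<open>v\<close> inside \<open>E\<close>.\<close>

lemma forest_insert:
  assumes "forest E" and "\<not> reachable_in E u v"
  shows "forest (insert {u, v} E)"
  unfolding forest_def
proof (intro allI impI notI)
  fix x y
  assume xy: "{x, y} \<in> insert {u, v} E" and r: "reachable_in (insert {u, v} E - {{x, y}}) x y"
  show False
  proof (cases "{x, y} = {u, v}")
    case True
    then have "reachable_in E x y" using r by (auto elim: reachable_in_mono)
    with True assms(2) show False by (auto simp: doubleton_eq_iff dest: reachable_in_sym)
  next
    case False
    let ?E = "E - {{x, y}}"
    from False xy have e: "{x, y} \<in> E" by simp
    from r False have "reachable_in (insert {u, v} ?E) x y" by (simp add: insert_Diff_if)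
    with forestD[OF assms(1) e]
    have "reachable_in ?E x u \<and> reachable_in ?E v y \<or> reachable_in ?E x v \<and> reachable_in ?E u y"
      by (simp add: reachable_in_insert)
    then have "reachable_in E x u \<and> reachable_in E v y \<or> reachable_in E x v \<and> reachable_in E u y"
      by (meson Diff_subset reachable_in_mono)
    with reachable_in_edge[OF e] assms(2) show False
      by (meson reachable_in_sym reachable_in_trans)
  qed
qed

lemma reachable_in_distinct_path:
  assumes "reachable_in E u v"
  obtains p where "p \<noteq> []" "hd p = u" "last p = v" "distinct p"
    "successively (\<lambda>x y. {x, y} \<in> E) p"
proof -
  have "\<exists>p. p \<noteq> [] \<and> hd p = u \<and> last p = v \<and> distinct p \<and> successively (\<lambda>x y. {x, y} \<in> E) p"
    using assms unfolding reachable_in_def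
  proof (induction rule: converse_rtranclp_induct)
    case base
    show ?case by (rule exI[of _ "[v]"]) simp
  next
    case (step u w)
    then obtain p where p: "p \<noteq> []" "hd p = w" "last p = v" "distinct p"
      "successively (\<lambda>x y. {x, y} \<in> E) p" by blast
    show ?case
    proof (cases "u \<in> set p")
      case True
      \<comment> \<open>The path returns to \<open>u\<close>, so its tail from that occurrence
        already serves.\<close>
      then obtain xs ys where "p = xs @ u # ys" by (auto simp: in_set_conv_decomp)
      with p show ?thesis
        by (intro exI[of _ "u # ys"]) (auto simp: successively_append_iff)
    next
      case False
      with p step.hyps show ?thesis
        by (intro exI[of _ "u # p"]) (auto simp: successively_Cons)
    qed
  qed
  then show thesis using that by blast
qed

text \<open>A cycle is a detour around its closing edge, and a repetition-free detour around an edge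
  closes up to a cycle. The cardinality hypothesis excludes loops, which \<open>graph_cycle\<close>
  does not detect.\<close>

lemma forest_iff_no_cycle:
  assumes "\<And>e. e \<in> E \<Longrightarrow> card e = 2"
  shows "forest E \<longleftrightarrow> \<not> (\<exists>p. graph_cycle E p)"
proof
  assume f: "forest E"
  show "\<not> (\<exists>p. graph_cycle E p)"
  proof
    assume "\<exists>p. graph_cycle E p"
    then obtain p where p: "3 \<le> length p" "distinct p"
      and e: "\<And>i. i < length p \<Longrightarrow> {p ! i, p ! (Suc i mod length p)} \<in> E"
      by (auto simp: graph_cycle_def)
    let ?n = "length p" and ?e = "{p ! (length p - 1), p ! 0}"
    have "Suc (?n - 1) = ?n" using p(1) by simp
    then have "?e \<in> E" using e[of "?n - 1"] by simp
    have *: "reachable_in (E - {?e}) (p ! 0) (p ! i)" if "i < ?n" for i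
      using that
    proof (induction i)
      case (Suc i)
      then have "{p ! i, p ! Suc i} \<in> E" using e[of i] by simp
      moreover have "{p ! i, p ! Suc i} \<noteq> ?e"
      proof
        assume "{p ! i, p ! Suc i} = ?e"
        then have "p ! i = p ! (?n - 1) \<and> p ! Suc i = p ! 0 \<or>
            p ! i = p ! 0 \<and> p ! Suc i = p ! (?n - 1)"
          by (auto simp: doubleton_eq_iff)
        moreover have "?n - 1 < ?n" "0 < ?n" using p(1) by linarith+
        ultimately show False
          using nth_eq_iff_index_eq[OF p(2), of i] nth_eq_iff_index_eq[OF p(2), of "Suc i"] Suc.prems p(1)
          by auto
      qed
      ultimately have "reachable_in (E - {?e}) (p ! i) (p ! Suc i)"
        by (intro reachable_in_edge) simp
      with Suc show ?case by (meson Suc_lessD reachable_in_trans)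
    qed simp
    have "reachable_in (E - {?e}) (p ! 0) (p ! (?n - 1))" using p(1) by (intro *) simp
    with forestD[OF f \<open>?e \<in> E\<close>] show False by (blast dest: reachable_in_sym)
  qed
next
  assume nc: "\<not> (\<exists>p. graph_cycle E p)"
  show "forest E"
    unfolding forest_def
  proof (intro allI impI notI)
    fix u v
    assume e: "{u, v} \<in> E" and r: "reachable_in (E - {{u, v}}) u v"
    have "u \<noteq> v" using assms[OF e] by auto
    from r obtain p where p: "p \<noteq> []" "hd p = u" "last p = v" "distinct p"
      and s: "successively (\<lambda>x y. {x, y} \<in> E - {{u, v}}) p"
      by (rule reachable_in_distinct_path)
    have s: "{p ! i, p ! Suc i} \<in> E - {{u, v}}" if "Suc i < length p" for i
      using s that by (auto simp: successively_conv_nth)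
    have h: "p ! 0 = u" "p ! (length p - 1) = v" using p by (auto simp: hd_conv_nth last_conv_nth)
    \<comment> \<open>Length 1 would make the edge a loop; length 2 would make the detour the
      removed edge itself.\<close>
    have "length p \<noteq> 0" using p by simp
    moreover have "length p \<noteq> 1" using h \<open>u \<noteq> v\<close> by auto
    moreover have "length p \<noteq> 2" using h s[of 0] by auto
    ultimately have l: "3 \<le> length p" by linarith
    have "{p ! i, p ! (Suc i mod length p)} \<in> E" if "i < length p" for i
    proof (cases "Suc i < length p")
      case True
      with s[OF True] show ?thesis by simp
    next
      case False
      with that have "i = length p - 1" "Suc i = length p" by simp_all
      with h e show ?thesis by (simp add: insert_commute)
    qed
    with l p(4) nc show False by (auto simp: graph_cycle_def)
  qed
qed

text \<open>Basis extension in the graphic matroid: to an inclusion-maximal forest between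
  \<open>F\<close> and \<open>E\<close>, any edge of \<open>E\<close> with unconnected ends could
  still be added by \<open>forest_insert\<close>.\<close>

lemma forest_extend:
  assumes "finite E" "F \<subseteq> E" "forest F"
  obtains M where "F \<subseteq> M" "M \<subseteq> E" "forest M" "reachable_in M = reachable_in E"
proof -
  define A where "A = {M. F \<subseteq> M \<and> M \<subseteq> E \<and> forest M}"
  have "finite A" unfolding A_def by (rule finite_subset[of _ "Pow E"]) (use assms in auto)
  moreover have "F \<in> A" using assms by (simp add: A_def)
  ultimately have "\<exists>M\<in>A. F \<subseteq> M \<and> (\<forall>N\<in>A. M \<subseteq> N \<longrightarrow> M = N)"
    by (rule finite_has_maximal2)
  then obtain M where "M \<in> A" and max: "\<forall>N\<in>A. M \<subseteq> N \<longrightarrow> M = N"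
    by (elim bexE conjE)
  then have M: "F \<subseteq> M" "M \<subseteq> E" "forest M" by (auto simp: A_def)
  have "reachable_in M x y" if "{x, y} \<in> E" for x y
  proof (rule ccontr)
    assume n: "\<not> reachable_in M x y"
    with M have "forest (insert {x, y} M)" by (intro forest_insert)
    with M that have "insert {x, y} M \<in> A" by (auto simp: A_def)
    with max have "M = insert {x, y} M" by blast
    then have "{x, y} \<in> M" by blast
    with n show False by (blast intro: reachable_in_edge)
  qed
  then have "reachable_in M = reachable_in E"
    using M(2) by (intro ext iffI) (auto elim: reachable_in_least reachable_in_mono)
  with M show thesis using that by blast
qed

section \<open>Components and the edge count of a forest\<close>

lemma graph_components_eq:
  "graph_components V E = (\<lambda>x. {y \<in> V. reachable_in E x y}) ` V"
proof -
  have "{(u, v). u \<in> V \<and> v \<in> V \<and> reachable_in E u v} `` {x} = {y \<in> V. reachable_in E x y}"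
    if "x \<in> V" for x
    using that by auto
  then show ?thesis unfolding graph_components_def quotient_def by auto
qed

text \<open>The classes \<open>C u\<close> and \<open>C v\<close> merge and all others stay. The
  work is to see that exactly two classes disappear and exactly one new class appears.\<close>

lemma card_components_insert:
  assumes "finite V" "u \<in> V" "v \<in> V" "\<not> reachable_in E u v"
  shows "card (graph_components V E) = Suc (card (graph_components V (insert {u, v} E)))"
proof -
  define C where "C = (\<lambda>x. {y \<in> V. reachable_in E x y})"
  define C' where "C' = (\<lambda>x. {y \<in> V. reachable_in (insert {u, v} E) x y})"
  have eqC: "C x = C y" if "reachable_in E x y" for x y
    using that unfolding C_def by (auto intro: reachable_in_trans reachable_in_sym)
  have memC: "x \<in> C x" if "x \<in> V" for x using that by (simp add: C_def)
  have C': "C' x = (if x \<in> C u \<union> C v then C u \<union> C v else C x)" if "x \<in> V" for x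
  proof -
    have "y \<in> C' x \<longleftrightarrow> y \<in> (if x \<in> C u \<union> C v then C u \<union> C v else C x)" for y
      using that unfolding C_def C'_def
      by (simp add: reachable_in_insert) (meson reachable_in_sym reachable_in_trans)
    then show ?thesis by blast
  qed
  have "v \<notin> C u" using assms(4) by (simp add: C_def)
  with memC[OF assms(3)] have uv: "C u \<noteq> C v" by metis
  have out: "C x = C u \<or> C x = C v \<or> x \<notin> C u \<union> C v" if "x \<in> V" for x
    using eqC[of u x] eqC[of v x] by (simp add: C_def) blast
  have "C' ` V = insert (C u \<union> C v) (C ` V - {C u, C v})" (is "?L = ?R")
  proof
    show "?L \<subseteq> ?R"
    proof (rule image_subsetI)
      fix x assume x: "x \<in> V"
      show "C' x \<in> ?R"
      proof (cases "x \<in> C u \<union> C v")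
        case False
        then have "C x \<noteq> C u" "C x \<noteq> C v" using memC[OF x] by auto
        with False x C'[OF x] show ?thesis by simp
      qed (use x C' in simp)
    qed
    show "?R \<subseteq> ?L"
    proof
      fix S assume "S \<in> ?R"
      then consider "S = C u \<union> C v" | x where "x \<in> V" "S = C x" "C x \<noteq> C u" "C x \<noteq> C v"
        by auto
      then show "S \<in> ?L"
      proof cases
        case 1
        then have "S = C' u" using C'[OF assms(2)] memC[OF assms(2)] by simp
        then show ?thesis using assms(2) by simp
      next
        case 2
        then have "S = C' x" using C'[of x] out[of x] by auto
        then show ?thesis using 2 by simp
      qed
    qed
  qed
  \<comment> \<open>The merged class is not among the surviving ones, so inserting it raises the
    cardinality by one.\<close>
  moreover have "C u \<union> C v \<notin> C ` V - {C u, C v}"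
  proof
    assume "C u \<union> C v \<in> C ` V - {C u, C v}"
    then obtain x where x: "x \<in> V" "C u \<union> C v = C x" "C x \<noteq> C u" "C x \<noteq> C v" by auto
    then have "x \<in> C u \<union> C v" using memC by blast
    with out[OF x(1)] x show False by blast
  qed
  ultimately have "card (C' ` V) = Suc (card (C ` V - {C u, C v}))"
    using assms(1) by simp
  also have "card (C ` V - {C u, C v}) = card (C ` V) - 2"
    using assms uv by (subst card_Diff_subset) auto
  finally have "card (C' ` V) = Suc (card (C ` V) - 2)" .
  \<comment> \<open>At least two classes exist, so the truncated subtraction of 2 is exact.\<close>
  moreover have "card {C u, C v} \<le> card (C ` V)"
    using assms by (intro card_mono) auto
  ultimately have "card (C ` V) = Suc (card (C' ` V))" using uv by simp
  then show ?thesis by (simp add: graph_components_eq C_def C'_def)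
qed

text \<open>Without edges every vertex is its own component; each further forest edge joins two
  vertices not yet connected and so lowers the number of components by one.\<close>

lemma forest_card:
  assumes "finite E" "finite V" "\<And>e. e \<in> E \<Longrightarrow> e \<subseteq> V \<and> card e = 2" "forest E"
  shows "card E + card (graph_components V E) = card V"
  using assms(1,3,4)
proof (induction E rule: finite_induct)
  case empty
  have "reachable_in {} x y \<longleftrightarrow> x = y" for x y :: 'a
    unfolding reachable_in_def by (auto elim: rtranclp.cases)
  then have "graph_components V {} = (\<lambda>x. {x}) ` V"
    unfolding graph_components_eq by auto
  then show ?case by (simp add: card_image)
next
  case (insert e E)
  then obtain u v where e: "e = {u, v}" by (meson card_2_iff insertI1)
  with insert.prems(1)[of e] have uv: "u \<in> V" "v \<in> V" by auto
  have "insert e E - {{u, v}} = E" using insert.hyps e by auto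
  with forestD[OF insert.prems(2), of u v] e have "\<not> reachable_in E u v" by simp
  then have "card (graph_components V E) = Suc (card (graph_components V (insert e E)))"
    unfolding e using assms(2) uv by (intro card_components_insert)
  moreover have "card E + card (graph_components V E) = card V"
    using insert.prems by (intro insert.IH) (auto intro: forest_subset)
  ultimately show ?case using insert.hyps by simp
qed

lemma graph_connected_components:
  assumes "graph_connected V E" "V \<noteq> {}"
  shows "graph_components V E = {V}"
proof -
  have "{y \<in> V. reachable_in E x y} = V" if "x \<in> V" for x
    using assms(1) that by (auto simp: graph_connected_def)
  with assms(2) show ?thesis by (auto simp: graph_components_eq)
qed

section \<open>Spanning trees and the exchange of cross edges\<close>

lemma spanning_trees_alt:
  assumes "\<And>e. e \<in> E \<Longrightarrow> card e = 2"
  shows "T \<in> spanning_trees V E \<longleftrightarrow> T \<subseteq> E \<and> graph_connected V T \<and> forest T"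
proof (cases "T \<subseteq> E")
  case True
  then have "forest T \<longleftrightarrow> \<not> (\<exists>p. graph_cycle T p)"
    using assms by (intro forest_iff_no_cycle) blast
  with True show ?thesis by (simp add: spanning_trees_def)
qed (simp add: spanning_trees_def)

lemma spanning_tree_exists:
  assumes "finite E" "\<And>e. e \<in> E \<Longrightarrow> card e = 2" "graph_connected V E"
  shows "spanning_trees V E \<noteq> {}"
proof -
  obtain M where "M \<subseteq> E" "forest M" "reachable_in M = reachable_in E"
    using forest_extend[of E "{}"] assms(1) by (auto simp: forest_def)
  then have "M \<in> spanning_trees V E"
    using assms by (simp add: spanning_trees_alt graph_connected_def)
  then show ?thesis by blast
qed

lemma spanning_tree_card:
  assumes "finite E" "finite V" "V \<noteq> {}" "\<And>e. e \<in> E \<Longrightarrow> e \<subseteq> V \<and> card e = 2"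
    "T \<in> spanning_trees V E"
  shows "Suc (card T) = card V"
proof -
  have T: "T \<subseteq> E" "graph_connected V T" "forest T"
    using assms spanning_trees_alt[of E T V] by auto
  moreover have "card T + card (graph_components V T) = card V"
    using assms T by (intro forest_card) (auto intro: finite_subset)
  ultimately show ?thesis using graph_connected_components assms(3) by fastforce
qed

text \<open>The components of \<open>H\<close> are the prescribed clusters and \<open>X\<close> is
  the set of edges between different clusters. The new tree keeps every edge of \<open>T\<close>
  outside \<open>X\<close>, so only edges of \<open>X\<close> are lost, and equal size bounds the
  number gained.\<close>

lemma spanning_tree_exchange:
  assumes "finite E" "finite V" "V \<noteq> {}" "\<And>e. e \<in> E \<Longrightarrow> e \<subseteq> V \<and> card e = 2"
    and T: "T \<in> spanning_trees V E" and H: "H \<subseteq> E"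
  defines "X \<equiv> {e \<in> E. \<exists>u\<in>e. \<exists>v\<in>e. \<not> reachable_in H u v}"
  obtains T' where "T' \<in> spanning_trees V E" "graph_components V (T' - X) = graph_components V H"
    "card (T' \<inter> X) = card (graph_components V H) - 1"
    "card (T - T') \<le> card X" "card (T' - T) \<le> card X"
proof -
  have T': "T \<subseteq> E" "graph_connected V T" "forest T"
    using assms spanning_trees_alt[of E T V] by auto
  have "X \<subseteq> E" by (auto simp: X_def)
  have "reachable_in H x y" if "{x, y} \<in> E - X" for x y
    using that by (auto simp: X_def)
  moreover have "H \<subseteq> E - X"
  proof
    fix e assume e: "e \<in> H"
    then obtain x y where xy: "e = {x, y}" using H assms(4) by (meson card_2_iff subsetD)
    with e have "reachable_in H x y" "reachable_in H y x"
      by (auto intro: reachable_in_edge reachable_in_sym)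
    with e xy H show "e \<in> E - X" by (auto simp: X_def)
  qed
  \<comment> \<open>The non-cross edges contain \<open>H\<close> and never leave a component of
    \<open>H\<close>.\<close>
  ultimately have rH: "reachable_in (E - X) = reachable_in H"
    by (intro ext iffI) (auto elim: reachable_in_least reachable_in_mono)
  \<comment> \<open>\<open>M\<close> spans each cluster by a tree; \<open>S\<close> below joins
    these trees by cross edges into one spanning tree.\<close>
  obtain M where M: "T - X \<subseteq> M" "M \<subseteq> E - X" "forest M" "reachable_in M = reachable_in (E - X)"
    by (rule forest_extend[of "E - X" "T - X"])
      (use assms(1) T' in \<open>auto intro: forest_subset\<close>)
  obtain S where S: "M \<subseteq> S" "S \<subseteq> E" "forest S" "reachable_in S = reachable_in E"
    by (rule forest_extend[of E M]) (use assms(1) M in auto)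
  have "graph_connected V S"
    using T' S unfolding graph_connected_def by (auto intro: reachable_in_mono)
  then have tree: "S \<in> spanning_trees V E" using S assms spanning_trees_alt[of E S V] by auto
  \<comment> \<open>An edge of \<open>S - X\<close> outside \<open>M\<close> would have ends already
    joined in \<open>M\<close>, so it would not be a bridge of \<open>S\<close>.\<close>
  have SX: "S - X = M"
  proof
    show "S - X \<subseteq> M"
    proof
      fix e assume e: "e \<in> S - X"
      then obtain x y where xy: "e = {x, y}" using S assms(4) by (meson card_2_iff subsetD DiffD1)
      show "e \<in> M"
      proof (rule ccontr)
        assume "e \<notin> M"
        then have "M \<subseteq> S - {{x, y}}" using S(1) xy by auto
        moreover have "{x, y} \<in> E - X" using e S xy by auto
        then have "reachable_in M x y" unfolding M(4) by (rule reachable_in_edge)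
        ultimately have "reachable_in (S - {{x, y}}) x y" by (blast intro: reachable_in_mono)
        with forestD[OF S(3)] e xy show False by auto
      qed
    qed
  qed (use M S in blast)
  then have comp: "graph_components V (S - X) = graph_components V H"
    using M(4) rH by (simp add: graph_components_def)
  have fin: "finite S" "finite T" "finite X"
    using S(2) T'(1) \<open>X \<subseteq> E\<close> assms(1) by (auto intro: finite_subset)
  have "card M + card (graph_components V M) = card V"
    by (rule forest_card) (use M(2,3) assms(1,2,4) in \<open>auto intro: finite_subset\<close>)
  then have cM: "card M + card (graph_components V H) = card V" using comp SX by simp
  have cS: "Suc (card S) = card V" and cT: "Suc (card T) = card V"
    using spanning_tree_card[OF assms(1-4)] tree T by auto
  have "card S = card M + card (S \<inter> X)"
    using card_Int_Diff[of S X] fin SX by simp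
  \<comment> \<open>This is the number of deleted edges that \<open>can_induce\<close>
    prescribes.\<close>
  then have cX: "card (S \<inter> X) = card (graph_components V H) - 1" using cM cS by linarith
  have "T - S \<subseteq> X" using M(1) S(1) by blast
  then have a: "card (T - S) \<le> card X" using fin by (intro card_mono)
  have "card (T - S) = card (S - T)"
    using cS cT fin card_Int_Diff[of S T] card_Int_Diff[of T S] by (simp add: Int_commute)
  with a that[OF tree comp cX] show thesis by simp
qed

section \<open>Counting edge sets that differ in few elements\<close>

lemma card_small_subsets_le:
  assumes "finite E"
  shows "card {A. A \<subseteq> E \<and> card A \<le> b} \<le> (card E + 1) ^ b"
proof -
  \<comment> \<open>A set of at most \<open>b\<close> edges is listed and padded with
    \<open>None\<close> to length \<open>b\<close>; the padding symbol accounts for the base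
    \<open>card E + 1\<close>.\<close>
  let ?L = "{xs. set xs \<subseteq> insert None (Some ` E) \<and> length xs = b}"
  have finL: "finite ?L" using assms by (intro finite_lists_length_eq) auto
  have "{A. A \<subseteq> E \<and> card A \<le> b} \<subseteq> (\<lambda>xs. {e. Some e \<in> set xs}) ` ?L"
  proof
    fix A assume "A \<in> {A. A \<subseteq> E \<and> card A \<le> b}"
    then have A: "A \<subseteq> E" "card A \<le> b" by auto
    with assms obtain xs where xs: "set xs = A" "length xs = card A"
      by (metis distinct_card finite_distinct_list finite_subset)
    let ?ys = "map Some xs @ replicate (b - card A) None"
    have "?ys \<in> ?L" "{e. Some e \<in> set ?ys} = A" using A xs by auto
    then show "A \<in> (\<lambda>xs. {e. Some e \<in> set xs}) ` ?L" by (intro image_eqI[of _ _ ?ys]) (rule sym)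
  qed
  then have "card {A. A \<subseteq> E \<and> card A \<le> b} \<le> card ?L"
    using finL by (rule surj_card_le[rotated])
  also have "card ?L = (card E + 1) ^ b"
    using assms by (subst card_lists_length_eq) (auto simp: card_image)
  finally show ?thesis .
qed

text \<open>\<open>A\<close> is recovered from its neighbour \<open>A'\<close> by removing
  \<open>A' - A\<close> and adding \<open>A - A'\<close>, and each of these two small sets has at
  most \<open>(card E + 1) ^ b\<close> possible values.\<close>

lemma card_le_of_small_differences:
  assumes "finite E" and S: "S \<subseteq> Pow E" and T: "R \<subseteq> Pow E"
    and near: "\<And>A. A \<in> R \<Longrightarrow> \<exists>A'\<in>S. card (A - A') \<le> b \<and> card (A' - A) \<le> b"
  shows "card R \<le> card S * (card E + 1) ^ (2 * b)"
proof -
  let ?P = "{A. A \<subseteq> E \<and> card A \<le> b}"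
  have fin: "finite ?P" "finite S"
    by (rule finite_subset[of _ "Pow E"], use assms in auto)+
  have "R \<subseteq> (\<lambda>(A', B, C). (A' - B) \<union> C) ` (S \<times> ?P \<times> ?P)"
  proof
    fix A assume A: "A \<in> R"
    then obtain A' where A': "A' \<in> S" "card (A - A') \<le> b" "card (A' - A) \<le> b" using near by blast
    then have "(A', A' - A, A - A') \<in> S \<times> ?P \<times> ?P" using A S T by auto
    then show "A \<in> (\<lambda>(A', B, C). (A' - B) \<union> C) ` (S \<times> ?P \<times> ?P)"
      by (rule rev_image_eqI) auto
  qed
  then have "card R \<le> card (S \<times> ?P \<times> ?P)"
    using fin by (intro surj_card_le) auto
  also have "\<dots> = card S * (card ?P * card ?P)" by (simp add: card_cartesian_product)
  also have "\<dots> \<le> card S * ((card E + 1) ^ b * (card E + 1) ^ b)"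
    using card_small_subsets_le[OF assms(1)] by (intro mult_le_mono) auto
  finally show ?thesis by (simp add: mult_2 power_add)
qed


section \<open>The mesh grid\<close>

lemma finite_mesh_verts [simp]: "finite (mesh_verts K)"
  by (simp add: mesh_verts_def)

lemma card_mesh_verts [simp]: "card (mesh_verts K) = K\<^sup>2"
  by (simp add: mesh_verts_def card_cartesian_product power2_eq_square)

lemma mesh_verts_nonempty: "K > 0 \<Longrightarrow> mesh_verts K \<noteq> {}"
  by (auto simp: mesh_verts_def)

lemma mesh_edges_wf: "e \<in> mesh_edges K \<Longrightarrow> e \<subseteq> mesh_verts K \<and> card e = 2"
  by (auto simp: mesh_edges_def mesh_verts_def)

lemma finite_mesh_edges [simp]: "finite (mesh_edges K)"
  by (rule finite_subset[of _ "Pow (mesh_verts K)"]) (auto dest: mesh_edges_wf)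

lemma card_mesh_edges_le: "card (mesh_edges K) \<le> 2 * ((K - 1) * K)"
proof -
  let ?f = "\<lambda>(i, j). {(i, j), (Suc i, j)}" and ?g = "\<lambda>(i, j). {(i, j), (i, Suc j)}"
  have "mesh_edges K \<subseteq> ?f ` ({..<K - 1} \<times> {..<K}) \<union> ?g ` ({..<K} \<times> {..<K - 1})"
  proof
    fix e assume "e \<in> mesh_edges K"
    then consider i j where "e = {(i, j), (Suc i, j)}" "Suc i < K" "j < K"
      | i j where "e = {(i, j), (i, Suc j)}" "i < K" "Suc j < K"
      by (auto simp: mesh_edges_def)
    then show "e \<in> ?f ` ({..<K - 1} \<times> {..<K}) \<union> ?g ` ({..<K} \<times> {..<K - 1})"
    proof cases
      case 1
      then have "e = ?f (i, j)" "(i, j) \<in> {..<K - 1} \<times> {..<K}" by auto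
      then show ?thesis by blast
    next
      case 2
      then have "e = ?g (i, j)" "(i, j) \<in> {..<K} \<times> {..<K - 1}" by auto
      then show ?thesis by blast
    qed
  qed
  then have "card (mesh_edges K) \<le> card (?f ` ({..<K - 1} \<times> {..<K}) \<union> ?g ` ({..<K} \<times> {..<K - 1}))"
    by (intro card_mono) auto
  also have "\<dots> \<le> card (?f ` ({..<K - 1} \<times> {..<K})) + card (?g ` ({..<K} \<times> {..<K - 1}))"
    by (rule card_Un_le)
  also have "\<dots> \<le> card ({..<K - 1} \<times> {..<K}) + card ({..<K} \<times> {..<K - 1})"
    by (intro add_mono card_image_le) auto
  also have "\<dots> = 2 * ((K - 1) * K)" by (simp add: card_cartesian_product mult.commute)
  finally show ?thesis .
qed

lemma graph_connected_mesh: "graph_connected (mesh_verts K) (mesh_edges K)"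
proof -
  have 1: "reachable_in (mesh_edges K) (0, j) (i, j)" if "i < K" "j < K" for i j
    using that
  proof (induction i)
    case (Suc i)
    then have "{(i, j), (Suc i, j)} \<in> mesh_edges K" by (auto simp: mesh_edges_def)
    with Suc show ?case by (meson Suc_lessD reachable_in_edge reachable_in_trans)
  qed simp
  have 2: "reachable_in (mesh_edges K) (0, 0) (0, j)" if "j < K" for j
    using that
  proof (induction j)
    case (Suc j)
    then have "{(0, j), (0, Suc j)} \<in> mesh_edges K"
      unfolding mesh_edges_def by (intro UnI2 CollectI exI[of _ 0] exI[of _ j]) simp
    with Suc show ?case by (meson Suc_lessD reachable_in_edge reachable_in_trans)
  qed simp
  have "reachable_in (mesh_edges K) (0, 0) v" if "v \<in> mesh_verts K" for v
    using that by (auto simp: mesh_verts_def intro: reachable_in_trans[OF 2 1])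
  then show ?thesis
    unfolding graph_connected_def by (meson reachable_in_sym reachable_in_trans)
qed

lemma finite_mesh_trees [simp]: "finite (mesh_trees K)"
  by (rule finite_subset[of _ "Pow (mesh_edges K)"]) (auto simp: mesh_trees_def spanning_trees_def)

lemma mesh_trees_nonempty: "mesh_trees K \<noteq> {}"
  unfolding mesh_trees_def
  by (intro spanning_tree_exists finite_mesh_edges graph_connected_mesh) (simp add: mesh_edges_wf)

section \<open>Blocks, their corners and unions of blocks\<close>

lemma block_side_corner: "i < K \<Longrightarrow> real i / real K \<in> block_side K i"
  by (auto simp: block_side_def divide_strict_right_mono)

lemma block_side_disjoint:
  assumes "i < j" "j < K" "x \<in> block_side K i" "x \<in> block_side K j"
  shows False
proof -
  have "x < real (Suc i) / real K" using assms by (simp add: block_side_def)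
  moreover have "real j / real K \<le> x" using assms by (auto simp: block_side_def split: if_splits)
  moreover have "real (Suc i) / real K \<le> real j / real K"
    using assms by (intro divide_right_mono) auto
  ultimately show False by linarith
qed

lemma block_side_unique:
  "i < K \<Longrightarrow> j < K \<Longrightarrow> x \<in> block_side K i \<Longrightarrow> x \<in> block_side K j \<Longrightarrow> i = j"
  using block_side_disjoint[of i j K x] block_side_disjoint[of j i K x] by (metis linorder_neqE_nat)

lemma block_unique:
  "u \<in> mesh_verts K \<Longrightarrow> v \<in> mesh_verts K \<Longrightarrow> p \<in> block K u \<Longrightarrow> p \<in> block K v \<Longrightarrow> u = v"
  by (auto simp: mesh_verts_def block_def prod_eq_iff intro: block_side_unique)

text \<open>The lower left corner. The half-open convention puts it inside its own block, so it
  serves as a test point that identifies the block.\<close>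

definition corner :: "nat \<Rightarrow> nat \<times> nat \<Rightarrow> real \<times> real" where
  "corner K v = (real (fst v) / real K, real (snd v) / real K)"

lemma corner_in_block: "v \<in> mesh_verts K \<Longrightarrow> corner K v \<in> block K v"
  by (auto simp: mesh_verts_def corner_def block_def intro: block_side_corner)

lemma inj_on_block: "inj_on (block K) (mesh_verts K)"
  using corner_in_block block_unique by (metis inj_onI)

lemma region_mem_iff:
  assumes "S \<subseteq> mesh_verts K" "v \<in> mesh_verts K"
  shows "corner K v \<in> region K S \<longleftrightarrow> v \<in> S"
  using assms corner_in_block block_unique unfolding region_def by blast

lemma inj_on_region: "inj_on (region K) (Pow (mesh_verts K))"
proof (rule inj_onI)
  fix S S' assume "S \<in> Pow (mesh_verts K)" "S' \<in> Pow (mesh_verts K)" "region K S = region K S'"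
  then have "v \<in> S \<longleftrightarrow> v \<in> S'" for v
    using region_mem_iff[of S K v] region_mem_iff[of S' K v] by auto
  then show "S = S'" by blast
qed

lemma graph_components_subset: "graph_components V E \<subseteq> Pow V"
  unfolding graph_components_eq by auto

lemma card_region_components:
  "card (region K ` graph_components (mesh_verts K) E) = card (graph_components (mesh_verts K) E)"
  by (intro card_image inj_on_subset[OF inj_on_region] graph_components_subset)

lemma closure_block_side:
  assumes "Suc i < K"
  shows "real (Suc i) / real K \<in> closure (block_side K i)"
proof -
  have "real i / real K < real (Suc i) / real K" using assms by (intro divide_strict_right_mono) auto
  then show ?thesis using assms by (simp add: block_side_def)
qed

text \<open>The edge is oriented so that \<open>v\<close> is its right or upper end. The last two
  facts give each end as one of two functions of the other, so that edges can be counted through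
  either end.\<close>

lemma mesh_edge_corner:
  assumes "e \<in> mesh_edges K"
  obtains u v where "e = {u, v}" "corner K v \<in> closure (block K u)"
    "u = (fst v - 1, snd v) \<or> u = (fst v, snd v - 1)"
    "v = (Suc (fst u), snd u) \<or> v = (fst u, Suc (snd u))"
proof -
  consider i j where "e = {(i, j), (Suc i, j)}" "Suc i < K" "j < K"
    | i j where "e = {(i, j), (i, Suc j)}" "i < K" "Suc j < K"
    using assms by (auto simp: mesh_edges_def)
  then show thesis
  proof cases
    case 1
    have "corner K (Suc i, j) \<in> closure (block K (i, j))"
      using closure_block_side[OF 1(2)] subsetD[OF closure_subset block_side_corner[OF 1(3)]]
      by (simp add: corner_def block_def closure_Times)
    with 1 that[of "(i, j)" "(Suc i, j)"] show thesis by simp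
  next
    case 2
    have "corner K (i, Suc j) \<in> closure (block K (i, j))"
      using closure_block_side[OF 2(3)] subsetD[OF closure_subset block_side_corner[OF 2(2)]]
      by (simp add: corner_def block_def closure_Times)
    with 2 that[of "(i, j)" "(i, Suc j)"] show thesis by simp
  qed
qed

section \<open>Counting corners on frontiers by covering numbers\<close>

lemma covering_number_attained:
  assumes "compact S" "\<delta> > 0"
  obtains P where "finite P" "card P = covering_number S \<delta>" "S \<subseteq> (\<Union>x\<in>P. cball x \<delta>)"
proof -
  \<comment> \<open>Compactness extracts a finite cover, which makes the \<open>LEAST\<close> in
    \<open>covering_number\<close> a genuine minimum.\<close>
  have "S \<subseteq> (\<Union>x\<in>S. ball x \<delta>)" using assms(2) by auto
  then obtain P where P: "finite P" "S \<subseteq> (\<Union>x\<in>P. ball x \<delta>)"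
    using compactE_image[OF assms(1), of S "\<lambda>x. ball x \<delta>"] by (metis open_ball)
  then have "S \<subseteq> (\<Union>x\<in>P. cball x \<delta>)" using ball_subset_cball by blast
  with P(1) have "\<exists>m P. finite P \<and> card P = m \<and> S \<subseteq> (\<Union>x\<in>P. cball x \<delta>)" by blast
  from LeastI_ex[OF this] that show thesis by (auto simp: covering_number_def)
qed

text \<open>After scaling by \<open>K\<close> these are integers in a closed interval of length
  2.\<close>

lemma card_lattice_near_le:
  fixes a :: real
  assumes "K > 0"
  shows "finite {i::nat. \<bar>real i / real K - a\<bar> \<le> 1 / real K}"
    "card {i::nat. \<bar>real i / real K - a\<bar> \<le> 1 / real K} \<le> 3"
proof -
  let ?A = "{i::nat. \<bar>real i / real K - a\<bar> \<le> 1 / real K}" and ?c = "\<lceil>a * real K\<rceil>"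
  have sub: "int ` ?A \<subseteq> {?c - 1..?c + 1}"
  proof (rule image_subsetI)
    fix i assume "i \<in> ?A"
    moreover have "real i / real K - a = (real i - a * real K) / real K"
      using assms by (simp add: field_simps)
    ultimately have "\<bar>real i - a * real K\<bar> \<le> 1"
      using assms by (simp add: abs_divide divide_le_cancel)
    then show "int i \<in> {?c - 1..?c + 1}" by (simp; linarith)
  qed
  then show "finite ?A" by (meson finite_atLeastAtMost_int finite_imageD finite_subset inj_on_of_nat)
  have "card ?A = card (int ` ?A)" by (simp add: card_image)
  also have "\<dots> \<le> card {?c - 1..?c + 1}" using sub by (intro card_mono) auto
  finally show "card ?A \<le> 3" by simp
qed

text \<open>A ball of radius \<open>1 / K\<close> confines each coordinate of a corner to three
  lattice values, hence nine corners per ball of an optimal cover.\<close>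

lemma card_corners_le:
  assumes "K > 0" "compact S"
  shows "card {v \<in> mesh_verts K. corner K v \<in> S} \<le> 9 * covering_number S (1 / real K)"
proof -
  obtain P where P: "finite P" "card P = covering_number S (1 / real K)"
    "S \<subseteq> (\<Union>x\<in>P. cball x (1 / real K))"
    using covering_number_attained[OF assms(2), of "1 / real K"] assms(1) by auto
  let ?N = "\<lambda>a. {i::nat. \<bar>real i / real K - a\<bar> \<le> 1 / real K}"
  have "{v \<in> mesh_verts K. corner K v \<in> S} \<subseteq> (\<Union>x\<in>P. ?N (fst x) \<times> ?N (snd x))"
  proof
    fix v assume "v \<in> {v \<in> mesh_verts K. corner K v \<in> S}"
    with P(3) obtain x where x: "x \<in> P" "dist x (corner K v) \<le> 1 / real K" by auto
    have "dist (fst x) (fst (corner K v)) \<le> 1 / real K"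
      using dist_fst_le[of x "corner K v"] x(2) by linarith
    moreover have "dist (snd x) (snd (corner K v)) \<le> 1 / real K"
      using dist_snd_le[of x "corner K v"] x(2) by linarith
    ultimately have "v \<in> ?N (fst x) \<times> ?N (snd x)"
      by (cases v) (simp add: corner_def dist_real_def abs_minus_commute)
    with x(1) show "v \<in> (\<Union>x\<in>P. ?N (fst x) \<times> ?N (snd x))" by blast
  qed
  then have "card {v \<in> mesh_verts K. corner K v \<in> S} \<le> card (\<Union>x\<in>P. ?N (fst x) \<times> ?N (snd x))"
    using P(1) card_lattice_near_le(1)[OF assms(1)] by (intro card_mono) auto
  also have "\<dots> \<le> (\<Sum>x\<in>P. card (?N (fst x) \<times> ?N (snd x)))" using P(1) by (rule card_UN_le)
  also have "\<dots> \<le> (\<Sum>x\<in>P. 3 * 3)"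
    unfolding card_cartesian_product
    by (intro sum_mono mult_le_mono card_lattice_near_le(2) assms(1))
  finally show ?thesis using P(2) by simp
qed

text \<open>Each cross edge is charged to a misplaced block or to a corner on a frontier. A
  misplaced block can be either end of an edge and pays for at most four; a corner belongs to the
  right or upper end and pays for two, which with nine corners per ball gives 18.\<close>

lemma card_cross_edges_le:
  fixes D R :: "'i \<Rightarrow> (real \<times> real) set"
  assumes K: "K > 0" and L: "finite L" "disjoint_family_on D L"
    and bdd: "\<And>l. l \<in> L \<Longrightarrow> bounded (D l)"
    and R: "R ` L = region K ` graph_components (mesh_verts K) H"
  shows "card {e \<in> mesh_edges K. \<exists>u\<in>e. \<exists>v\<in>e. \<not> reachable_in H u v} \<le>
    4 * (\<Sum>j\<in>L. card {B \<in> block K ` mesh_verts K. B \<subseteq> R j \<and> \<not> B \<subseteq> D j}) +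
    18 * (\<Sum>l\<in>L. covering_number (frontier (D l)) (1 / real K))"
proof -
  let ?V = "mesh_verts K"
  define C where "C = (\<lambda>u. {y \<in> ?V. reachable_in H u y})"
  define X where "X = {e \<in> mesh_edges K. \<exists>u\<in>e. \<exists>v\<in>e. \<not> reachable_in H u v}"
  define bad where "bad = (\<lambda>j. {v \<in> ?V. block K v \<subseteq> R j \<and> \<not> block K v \<subseteq> D j})"
  define W where "W = (\<lambda>l. {v \<in> ?V. corner K v \<in> frontier (D l)})"
  define BB where "BB = (\<Union>j\<in>L. bad j)"
  define WW where "WW = (\<Union>l\<in>L. W l)"
  have fin: "finite BB" "finite WW"
    using L(1) by (auto simp: BB_def WW_def bad_def W_def)
  have idx: "\<exists>j\<in>L. R j = region K (C u)" if "u \<in> ?V" for u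
  proof -
    have "region K (C u) \<in> R ` L" unfolding R graph_components_eq C_def using that by blast
    then show ?thesis by auto
  qed
  have sub: "block K u \<subseteq> region K (C u)" if "u \<in> ?V" for u
    using that unfolding region_def C_def by (intro UN_upper) simp
  \<comment> \<open>If neither block is misplaced, they lie in disjoint sets \<open>D j\<close> and
    \<open>D m\<close>; the corner of \<open>v\<close> is then in the closure of \<open>D j\<close>
    but not in \<open>D j\<close>, hence on its frontier.\<close>
  have good: "v \<in> WW" if uv: "u \<in> ?V" "v \<in> ?V" "\<not> reachable_in H u v"
    and "u \<notin> BB" "v \<notin> BB" and cl: "corner K v \<in> closure (block K u)" for u v
  proof -
    obtain j m where j: "j \<in> L" "R j = region K (C u)" and m: "m \<in> L" "R m = region K (C v)"
      using idx uv by meson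
    have Dj: "block K u \<subseteq> D j" using \<open>u \<notin> BB\<close> j sub[OF uv(1)] uv(1) by (auto simp: BB_def bad_def)
    have Dm: "block K v \<subseteq> D m" using \<open>v \<notin> BB\<close> m sub[OF uv(2)] uv(2) by (auto simp: BB_def bad_def)
    have c: "corner K v \<in> block K v" using uv(2) by (rule corner_in_block)
    have "j \<noteq> m"
    proof
      assume "j = m"
      with c sub[OF uv(2)] j m have "corner K v \<in> region K (C u)" by auto
      then have "v \<in> C u" using region_mem_iff[of "C u" K v] uv(2) by (auto simp: C_def)
      with uv(3) show False by (simp add: C_def)
    qed
    with L(2) j m have "D j \<inter> D m = {}" by (auto simp: disjoint_family_on_def)
    with c Dm have "corner K v \<notin> D j" by blast
    moreover have "corner K v \<in> closure (D j)" using cl closure_mono[OF Dj] by blast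
    ultimately have "corner K v \<in> frontier (D j)"
      using interior_subset by (auto simp: frontier_def)
    with uv(2) j(1) show ?thesis by (auto simp: WW_def W_def)
  qed
  \<comment> \<open>The edges to the left, lower, right and upper neighbour. On the border they may
    be no mesh edges, which is harmless for an upper bound.\<close>
  define d1 where "d1 = (\<lambda>v::nat \<times> nat. {(fst v - 1, snd v), v})"
  define d2 where "d2 = (\<lambda>v::nat \<times> nat. {(fst v, snd v - 1), v})"
  define u1 where "u1 = (\<lambda>v::nat \<times> nat. {v, (Suc (fst v), snd v)})"
  define u2 where "u2 = (\<lambda>v::nat \<times> nat. {v, (fst v, Suc (snd v))})"
  have "X \<subseteq> (d1 ` WW \<union> d2 ` WW) \<union> ((d1 ` BB \<union> d2 ` BB) \<union> (u1 ` BB \<union> u2 ` BB))"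
  proof
    fix e assume "e \<in> X"
    then have e: "e \<in> mesh_edges K" by (simp add: X_def)
    from e obtain u v where uv: "e = {u, v}" "corner K v \<in> closure (block K u)"
      "u = (fst v - 1, snd v) \<or> u = (fst v, snd v - 1)"
      "v = (Suc (fst u), snd u) \<or> v = (fst u, Suc (snd u))"
      by (rule mesh_edge_corner)
    have V: "u \<in> ?V" "v \<in> ?V" using mesh_edges_wf[OF e] uv(1) by auto
    have "\<not> reachable_in H u v"
      using \<open>e \<in> X\<close> uv(1) by (auto simp: X_def dest: reachable_in_sym)
    then have "v \<in> WW \<or> v \<in> BB \<or> u \<in> BB" using good V uv(2) by blast
    moreover have "e = d1 v \<or> e = d2 v" using uv(1,3) by (auto simp: d1_def d2_def)
    moreover have "e = u1 u \<or> e = u2 u" using uv(1,4) by (auto simp: u1_def u2_def)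
    ultimately show "e \<in> (d1 ` WW \<union> d2 ` WW) \<union> ((d1 ` BB \<union> d2 ` BB) \<union> (u1 ` BB \<union> u2 ` BB))"
      by blast
  qed
  then have "card X \<le> card ((d1 ` WW \<union> d2 ` WW) \<union> ((d1 ` BB \<union> d2 ` BB) \<union> (u1 ` BB \<union> u2 ` BB)))"
    using fin by (intro card_mono) auto
  also have "\<dots> \<le> (card WW + card WW) + ((card BB + card BB) + (card BB + card BB))"
    using fin by (intro order_trans[OF card_Un_le] add_mono card_image_le)
  finally have "card X \<le> 4 * card BB + 2 * card WW" by simp
  moreover have "card BB \<le> (\<Sum>j\<in>L. card {B \<in> block K ` ?V. B \<subseteq> R j \<and> \<not> B \<subseteq> D j})"
  proof -
    have "card BB \<le> (\<Sum>j\<in>L. card (bad j))" unfolding BB_def using L(1) by (rule card_UN_le)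
    moreover have "card (bad j) = card {B \<in> block K ` ?V. B \<subseteq> R j \<and> \<not> B \<subseteq> D j}" for j
    proof -
      have "{B \<in> block K ` ?V. B \<subseteq> R j \<and> \<not> B \<subseteq> D j} = block K ` bad j"
        by (auto simp: bad_def)
      moreover have "inj_on (block K) (bad j)"
        by (rule inj_on_subset[OF inj_on_block]) (auto simp: bad_def)
      ultimately show ?thesis by (simp add: card_image)
    qed
    ultimately show ?thesis by simp
  qed
  moreover have "card WW \<le> (\<Sum>l\<in>L. 9 * covering_number (frontier (D l)) (1 / real K))"
  proof -
    have "card WW \<le> (\<Sum>l\<in>L. card (W l))" unfolding WW_def using L(1) by (rule card_UN_le)
    also have "\<dots> \<le> (\<Sum>l\<in>L. 9 * covering_number (frontier (D l)) (1 / real K))"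
      unfolding W_def using bdd K by (intro sum_mono card_corners_le compact_frontier_bounded)
    finally show ?thesis .
  qed
  ultimately show ?thesis unfolding X_def by (simp flip: sum_distrib_left)
qed

text \<open>A pure power of \<open>K\<close> without a constant factor keeps the final bound valid
  for \<open>K = 1\<close>, where \<open>ln K\<close> vanishes.\<close>

lemma card_mesh_edges_Suc_le: "K > 0 \<Longrightarrow> card (mesh_edges K) + 1 \<le> K ^ 3"
proof -
  assume "K > 0"
  then obtain m where m: "K = Suc m" by (cases K) auto
  have "card (mesh_edges K) + 1 \<le> 2 * (m * Suc m) + 1" using card_mesh_edges_le[of K] m by simp
  also have "\<dots> \<le> Suc m ^ 3"
  proof -
    have "m \<le> m ^ 3" by (cases m) (auto simp: power3_eq_cube)
    then show ?thesis by (simp add: power3_eq_cube algebra_simps)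
  qed
  finally show ?thesis using m by simp
qed

text \<open>Exchange and counting combined: the factor \<open>card (mesh_edges K) + 1\<close>
  contributes the exponent 3, and the two exchanged sets contribute 2 per cross edge.\<close>

lemma card_mesh_trees_le:
  assumes K: "K > 0" and H: "H \<subseteq> mesh_edges K"
    and \<pi>: "\<pi> = region K ` graph_components (mesh_verts K) H"
  shows "card (mesh_trees K) \<le> card {T \<in> mesh_trees K. can_induce K T \<pi>} *
    K ^ (6 * card {e \<in> mesh_edges K. \<exists>u\<in>e. \<exists>v\<in>e. \<not> reachable_in H u v})"
proof -
  let ?S = "{T \<in> mesh_trees K. can_induce K T \<pi>}" and ?V = "mesh_verts K"
  define X where "X = {e \<in> mesh_edges K. \<exists>u\<in>e. \<exists>v\<in>e. \<not> reachable_in H u v}"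
  have "card (mesh_trees K) \<le> card ?S * (card (mesh_edges K) + 1) ^ (2 * card X)"
  proof (rule card_le_of_small_differences)
    fix T assume "T \<in> mesh_trees K"
    then have T: "T \<in> spanning_trees ?V (mesh_edges K)" by (simp add: mesh_trees_def)
    obtain T' where T': "T' \<in> spanning_trees ?V (mesh_edges K)"
      "graph_components ?V (T' - X) = graph_components ?V H"
      "card (T' \<inter> X) = card (graph_components ?V H) - 1"
      "card (T - T') \<le> card X" "card (T' - T) \<le> card X"
      by (rule spanning_tree_exchange[OF finite_mesh_edges finite_mesh_verts
        mesh_verts_nonempty[OF K] mesh_edges_wf T H, folded X_def])
    have "can_induce K T' \<pi>"
      unfolding can_induce_def
    proof (intro exI conjI)
      \<comment> \<open>The edges to delete are the cross edges of the new tree.\<close>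
      show "T' \<inter> X \<subseteq> T'" by simp
      show "card (T' \<inter> X) = card \<pi> - 1" using T'(3) by (simp add: \<pi> card_region_components)
      have "T' - T' \<inter> X = T' - X" by blast
      then show "\<pi> = region K ` graph_components ?V (T' - T' \<inter> X)" using T'(2) \<pi> by simp
    qed
    with T' show "\<exists>T'\<in>?S. card (T - T') \<le> card X \<and> card (T' - T) \<le> card X"
      by (auto simp: mesh_trees_def)
  qed (auto simp: mesh_trees_def spanning_trees_def)
  also have "\<dots> \<le> card ?S * (K ^ 3) ^ (2 * card X)"
    using card_mesh_edges_Suc_le[OF K] by (intro mult_le_mono power_mono) auto
  finally show ?thesis by (simp add: X_def flip: power_mult)
qed

section \<open>The support of the prior\<close>

lemma partition_spaceD:
  assumes lam: "lam > 0" and K: "K > 0" and \<pi>: "\<pi> \<in> partition_space lam K"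
  shows "card \<pi> \<le> K\<^sup>2" "\<exists>T\<in>mesh_trees K. can_induce K T \<pi>"
proof -
  let ?V = "mesh_verts K"
  have "\<pi> \<in> set_pmf (partition_prior lam K)"
    using \<pi> by (simp add: partition_space_def set_pmf_iff)
  moreover have "set_pmf (poisson_pmf lam) \<inter> {1..K\<^sup>2} \<noteq> {}" using lam K by simp
  ultimately obtain T k where T: "T \<in> mesh_trees K" and k: "1 \<le> k" "k \<le> K\<^sup>2"
    and mem: "\<pi> \<in> set_pmf (pmf_of_set {\<pi>. card \<pi> = k \<and> can_induce K T \<pi>})" 
      (is "_ \<in> set_pmf (pmf_of_set ?A)")
    unfolding partition_prior_def
    by (auto simp: set_pmf_of_set[OF mesh_trees_nonempty finite_mesh_trees] set_cond_pmf)
  \<comment> \<open>The support of \<open>pmf_of_set\<close> is known only for a finite nonempty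
    set, so both properties of \<open>?A\<close> are established first.\<close>
  have "finite ?A"
  proof (rule finite_subset)
    show "?A \<subseteq> Pow (region K ` Pow ?V)"
      using graph_components_subset by (fastforce simp: can_induce_def)
  qed simp
  moreover have "?A \<noteq> {}"
  proof -
    have tree: "T \<in> spanning_trees ?V (mesh_edges K)" using T by (simp add: mesh_trees_def)
    then have sT: "T \<subseteq> mesh_edges K" "forest T"
      using spanning_trees_alt[of "mesh_edges K" T ?V] mesh_edges_wf by auto
    then have fT: "finite T" using finite_subset[OF sT(1)] by simp
    have cT: "Suc (card T) = K\<^sup>2"
      using spanning_tree_card[OF finite_mesh_edges finite_mesh_verts
        mesh_verts_nonempty[OF K] mesh_edges_wf tree] by simp
    \<comment> \<open>Deleting any \<open>k - 1\<close> edges of \<open>T\<close> leaves exactly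
      \<open>k\<close> components, which provides an element of \<open>?A\<close>.\<close>
    then have "k - 1 \<le> card T" using k by linarith
    then obtain F where F: "F \<subseteq> T" "card F = k - 1"
      by (meson obtain_subset_with_card_n)
    have "card (T - F) + card (graph_components ?V (T - F)) = card ?V"
    proof (rule forest_card)
      show "forest (T - F)" using sT(2) by (rule forest_subset) blast
    qed (use sT fT mesh_edges_wf in auto)
    moreover have "card (T - F) = card T - (k - 1)"
      using F fT by (simp add: card_Diff_subset finite_subset)
    ultimately have "card (graph_components ?V (T - F)) = k"
      using cT k \<open>k - 1 \<le> card T\<close> by simp
    then have "region K ` graph_components ?V (T - F) \<in> ?A"
      using F by (auto simp: can_induce_def card_region_components)
    then show ?thesis by blast
  qed
  ultimately have "\<pi> \<in> ?A" using mem by simp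
  with T k show "card \<pi> \<le> K\<^sup>2" "\<exists>T\<in>mesh_trees K. can_induce K T \<pi>" by auto
qed

text \<open>The difference \<open>2 * (K - 1)^2 - (K^2 - 1)\<close> equals
  \<open>(K - 1) * (K - 3)\<close>, which is negative for no positive integer except
  \<open>K = 2\<close>.\<close>

lemma partition_size_le:
  fixes K k :: nat
  assumes "K > 0" "k \<le> K\<^sup>2" "\<not> (K = 2 \<and> k = 4)"
  shows "k - 1 \<le> 2 * (K - 1)\<^sup>2"
proof -
  consider "K = 1" | "K = 2" | "K \<ge> 3" using assms(1) by linarith
  then show ?thesis
  proof cases
    case 3
    then obtain m where "K = m + 3" by (metis add.commute le_Suc_ex)
    then show ?thesis using assms(2) by (simp add: power2_eq_square algebra_simps)
  qed (use assms in auto)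
qed


section \<open>The ratio of tree counts\<close>

text \<open>The case \<open>K n = 2\<close>, \<open>card \<pi> = 4\<close> is set apart because
  there the binomial coefficient is 2 over 3, that is 0, while every spanning tree induces the
  partition into four single blocks. The constant is chosen before \<open>n\<close> and
  \<open>\<pi>\<close>, hence uniform in both.\<close>

theorem propositionS2:
  fixes K k0 :: "nat \<Rightarrow> nat"
    and D Dref :: "nat \<Rightarrow> nat \<Rightarrow> (real \<times> real) set"
    and lam c c' C' :: real
  assumes lam_pos: "lam > 0"
    and K_pos: "\<And>n. K n > 0"
    and c'_pos: "c' > 0" and C'_pos: "C' > 0"
    and D_disjoint: "\<And>n. disjoint_family_on (D n) {1..k0 n}"
    and D_cover: "\<And>n. (\<Union>l\<in>{1..k0 n}. D n l) = unit_square"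
    and D_measurable: "\<And>n l. l \<in> {1..k0 n} \<Longrightarrow> D n l \<in> sets lebesgue"
    and area: "\<And>n l. l \<in> {1..k0 n} \<Longrightarrow>
          c' / real (k0 n) \<le> measure lebesgue (D n l) \<and>
          measure lebesgue (D n l) \<le> C' / real (k0 n)"
    and has_length: "\<And>n l. l \<in> {1..k0 n} \<Longrightarrow> has_boundary_length (D n l)"
    and length_area: "\<And>n l. l \<in> {1..k0 n} \<Longrightarrow>
          c' \<le> boundary_length (D n l) / sqrt (measure lebesgue (D n l)) \<and>
          boundary_length (D n l) / sqrt (measure lebesgue (D n l)) \<le> C'"
    and covering: "\<And>n l \<delta>. l \<in> {1..k0 n} \<Longrightarrow> 0 < \<delta> \<Longrightarrow> \<delta> < boundary_length (D n l) \<Longrightarrow>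
          real (covering_number (frontier (D n l)) \<delta>) \<le> C' * boundary_length (D n l) / \<delta>"
    and paths: "\<And>n l s s'. l \<in> {1..k0 n} \<Longrightarrow> s \<in> D n l \<Longrightarrow> s' \<in> D n l \<Longrightarrow>
          \<exists>g. path g \<and> path_image g \<subseteq> D n l \<and> pathstart g = s \<and> pathfinish g = s' \<and>
              (setdist (path_image g) (frontier (D n l)) =
                 min (infdist s (frontier (D n l))) (infdist s' (frontier (D n l))) \<or>
               setdist (path_image g) (frontier (D n l)) \<ge> C')"
    and ref_distinct: "\<And>n. inj_on (Dref n) {1..k0 n}"
    and ref_in_space: "\<And>n. Dref n ` {1..k0 n} \<in> partition_space lam (K n)"
    and ref_close: "\<And>n. real (\<Sum>j = 1..k0 n.
          card {B \<in> block (K n) ` mesh_verts (K n). B \<subseteq> Dref n j \<and> \<not> B \<subseteq> D n j})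
          \<le> c * sqrt (real (k0 n)) * real (K n)"
  shows "\<exists>C>0. \<forall>n. \<forall>\<pi>\<in>partition_space lam (K n).
           \<not> (K n = 2 \<and> card \<pi> = 4) \<longrightarrow>
           real (card {T \<in> mesh_trees (K n). can_induce (K n) T \<pi>}) /
           real (card {T \<in> mesh_trees (K n). can_induce (K n) T (Dref n ` {1..k0 n})})
           \<le> exp (C * sqrt (real (k0 n)) * real (K n) * ln (real (K n))) *
             real ((2 * (K n - 1)\<^sup>2) choose (card \<pi> - 1))"
proof -
  \<comment> \<open>The summands pay for misplaced blocks, for frontier corners, and for meshes too
    coarse for the covering hypothesis. The absolute value is taken since \<open>c\<close> may have
    any sign.\<close>
  define C0 where "C0 = 4 * \<bar>c\<bar> + 18 * (C'\<^sup>2 * sqrt C') + 2 / (c' * sqrt c')"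
  have C0: "C0 > 0" using c'_pos C'_pos by (simp add: C0_def add_nonneg_pos)
  have main: "real (card {T \<in> mesh_trees (K n). can_induce (K n) T \<pi>}) /
      real (card {T \<in> mesh_trees (K n). can_induce (K n) T (Dref n ` {1..k0 n})})
      \<le> exp ((6 * C0) * sqrt (real (k0 n)) * real (K n) * ln (real (K n))) *
        real ((2 * (K n - 1)\<^sup>2) choose (card \<pi> - 1))"
    if \<pi>: "\<pi> \<in> partition_space lam (K n)" and small: "\<not> (K n = 2 \<and> card \<pi> = 4)" for n \<pi>
  proof -
    let ?k = "k0 n" and ?K = "K n" and ?L = "{1..k0 n}"
    let ?ref = "Dref n ` {1..k0 n}"
    let ?S = "{T \<in> mesh_trees ?K. can_induce ?K T ?ref}"
    have K: "?K > 0" by (rule K_pos)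
    have "unit_square \<noteq> {}" by (auto simp: unit_square_def)
    with D_cover[of n] have k: "?k > 0" by (cases "?k") auto
    obtain T0 where T0: "T0 \<in> mesh_trees ?K" "can_induce ?K T0 ?ref"
      using partition_spaceD(2)[OF lam_pos K ref_in_space] by blast
    then obtain F where F: "?ref = region ?K ` graph_components (mesh_verts ?K) (T0 - F)"
      by (auto simp: can_induce_def)
    have H: "T0 - F \<subseteq> mesh_edges ?K"
      using T0(1) by (auto simp: mesh_trees_def spanning_trees_def)
    define b where "b = card {e \<in> mesh_edges ?K. \<exists>u\<in>e. \<exists>v\<in>e. \<not> reachable_in (T0 - F) u v}"
    have b: "real b \<le> C0 * sqrt ?k * ?K"
    \<comment> \<open>The covering hypothesis at scale \<open>1 / K\<close> requires longer
      boundaries. If one boundary is too short, \<open>K\<close> is at most a constant times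
      \<open>sqrt k0\<close>, and even the count of all mesh edges, below \<open>2 * K^2\<close>, is
      small enough.\<close>
    proof (cases "\<exists>l\<in>?L. boundary_length (D n l) \<le> 1 / ?K")
      case True
      then obtain l where l: "l \<in> ?L" "boundary_length (D n l) \<le> 1 / ?K" by blast
      let ?m = "measure lebesgue (D n l)"
      have m: "c' / ?k \<le> ?m" using area[OF l(1)] by simp
      have "0 < c' / ?k" using c'_pos k by simp
      with m have "0 < sqrt ?m" by simp
      then have "c' * sqrt ?m \<le> boundary_length (D n l)"
        using length_area[OF l(1)] by (simp add: pos_le_divide_eq)
      moreover have "c' * sqrt (c' / ?k) \<le> c' * sqrt ?m" using m c'_pos by simp
      ultimately have "c' * sqrt (c' / ?k) \<le> 1 / ?K" using l(2) by linarith
      then have "c' * sqrt c' * ?K \<le> sqrt ?k"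
        using k K by (simp add: real_sqrt_divide field_simps)
      then have Kk: "?K \<le> 1 / (c' * sqrt c') * sqrt ?k"
        using c'_pos by (simp add: field_simps)
      have "b \<le> card (mesh_edges ?K)" unfolding b_def by (intro card_mono) auto
      also have "\<dots> \<le> 2 * ((?K - 1) * ?K)" by (rule card_mesh_edges_le)
      also have "\<dots> \<le> 2 * (?K * ?K)" by simp
      finally have "real b \<le> real (2 * (?K * ?K))" by (rule of_nat_mono)
      then have "real b \<le> 2 * (real ?K * real ?K)" by simp
      also have "\<dots> \<le> 2 * ((1 / (c' * sqrt c') * sqrt ?k) * real ?K)"
        using Kk by (intro mult_left_mono mult_right_mono) auto
      also have "\<dots> = 2 / (c' * sqrt c') * (sqrt ?k * ?K)" by simp
      also have "\<dots> \<le> C0 * (sqrt ?k * ?K)"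
        using C'_pos by (intro mult_right_mono) (auto simp: C0_def)
      finally show ?thesis by (simp add: mult.assoc)
    next
      case False
      have "bounded unit_square"
        by (simp add: unit_square_def bounded_Times)
      moreover have "D n l \<subseteq> unit_square" if "l \<in> ?L" for l
        using D_cover[of n] that by blast
      ultimately have bdd: "bounded (D n l)" if "l \<in> ?L" for l
        using that by (meson bounded_subset)
      \<comment> \<open>A boundary has length at most \<open>C' * sqrt (C' / k0)\<close>; summing
        over the \<open>k0\<close> sub-domains later turns \<open>1 / sqrt k0\<close> into
        \<open>sqrt k0\<close>.\<close>
      have N: "real (covering_number (frontier (D n l)) (1 / ?K)) \<le> C'\<^sup>2 * sqrt C' / sqrt ?k * ?K"
        if l: "l \<in> ?L" for l
      proof -
        let ?m = "measure lebesgue (D n l)"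
        have "0 < c' / ?k" using c'_pos k by simp
        with area[OF l] have m: "0 < sqrt ?m" "?m \<le> C' / ?k" by auto
        then have "boundary_length (D n l) \<le> C' * sqrt ?m"
          using length_area[OF l] by (simp add: pos_divide_le_eq)
        also have "\<dots> \<le> C' * sqrt (C' / ?k)" using m(2) C'_pos by simp
        finally have bl: "boundary_length (D n l) \<le> C' * sqrt (C' / ?k)" .
        have "real (covering_number (frontier (D n l)) (1 / ?K))
            \<le> C' * boundary_length (D n l) / (1 / ?K)"
          using False l K by (intro covering) (auto simp: not_le)
        also have "\<dots> = C' * boundary_length (D n l) * ?K" by simp
        also have "\<dots> \<le> C' * (C' * sqrt (C' / ?k)) * ?K"
          using bl C'_pos by (intro mult_right_mono mult_left_mono) auto
        finally show ?thesis by (simp add: real_sqrt_divide power2_eq_square mult.assoc)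
      qed
      let ?bad = "\<Sum>j\<in>?L. card {B \<in> block ?K ` mesh_verts ?K. B \<subseteq> Dref n j \<and> \<not> B \<subseteq> D n j}"
      let ?cov = "\<Sum>l\<in>?L. covering_number (frontier (D n l)) (1 / ?K)"
      have "b \<le> 4 * ?bad + 18 * ?cov"
        unfolding b_def by (rule card_cross_edges_le[OF K _ D_disjoint bdd F]) auto
      then have "real b \<le> real (4 * ?bad + 18 * ?cov)" by (rule of_nat_mono)
      also have "\<dots> = 4 * real ?bad + 18 * real ?cov" by simp
      also have "\<dots> \<le> 4 * (\<bar>c\<bar> * (sqrt ?k * ?K)) + 18 * (C'\<^sup>2 * sqrt C' * (sqrt ?k * ?K))"
      proof (intro add_mono mult_left_mono)
        have "real ?bad \<le> c * (sqrt ?k * ?K)" using ref_close[of n] by (simp add: mult.assoc)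
        also have "\<dots> \<le> \<bar>c\<bar> * (sqrt ?k * ?K)" by (intro mult_right_mono) auto
        finally show "real ?bad \<le> \<bar>c\<bar> * (sqrt ?k * ?K)" .
        have "real ?cov \<le> (\<Sum>l\<in>?L. C'\<^sup>2 * sqrt C' / sqrt ?k * ?K)"
          unfolding of_nat_sum by (intro sum_mono N)
        also have "\<dots> = C'\<^sup>2 * sqrt C' * (?k / sqrt ?k * ?K)" by simp
        also have "?k / sqrt ?k = sqrt ?k" by (simp add: real_div_sqrt)
        finally show "real ?cov \<le> C'\<^sup>2 * sqrt C' * (sqrt ?k * ?K)" .
      qed auto
      also have "\<dots> = (4 * \<bar>c\<bar> + 18 * (C'\<^sup>2 * sqrt C')) * (sqrt ?k * ?K)"
        by (simp add: algebra_simps)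
      also have "\<dots> \<le> C0 * (sqrt ?k * ?K)"
        using c'_pos by (intro mult_right_mono) (auto simp: C0_def)
      finally show ?thesis by (simp add: mult.assoc)
    qed
    have S: "card ?S > 0"
      using T0 by (subst card_gt_0_iff) auto
    \<comment> \<open>The numerator is bounded by the number of all spanning trees, whatever
      \<open>\<pi>\<close> is.\<close>
    have "card {T \<in> mesh_trees ?K. can_induce ?K T \<pi>} \<le> card (mesh_trees ?K)"
      by (intro card_mono) auto
    also have "\<dots> \<le> card ?S * ?K ^ (6 * b)"
      unfolding b_def by (rule card_mesh_trees_le[OF K H F])
    finally have "real (card {T \<in> mesh_trees ?K. can_induce ?K T \<pi>}) \<le> real (card ?S * ?K ^ (6 * b))"
      by (rule of_nat_mono)
    then have "real (card {T \<in> mesh_trees ?K. can_induce ?K T \<pi>}) / real (card ?S) \<le> real ?K ^ (6 * b)"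
      using S by (simp add: pos_divide_le_eq mult.commute)
    \<comment> \<open>The exponent \<open>6 * b\<close> is the origin of the final constant
      \<open>6 * C0\<close>.\<close>
    also have "\<dots> = exp (real (6 * b) * ln ?K)" using K by (subst exp_of_nat_mult) simp
    also have "\<dots> \<le> exp ((6 * C0) * sqrt ?k * ?K * ln ?K)"
      using b K by (intro exp_mono mult_right_mono) auto
    also have "\<dots> \<le> \<dots> * real ((2 * (?K - 1)\<^sup>2) choose (card \<pi> - 1))"
    proof -
      have "card \<pi> - 1 \<le> 2 * (?K - 1)\<^sup>2"
        using partition_size_le[OF K partition_spaceD(1)[OF lam_pos K \<pi>] small] .
      then have "1 \<le> real ((2 * (?K - 1)\<^sup>2) choose (card \<pi> - 1))"
        by (simp add: Suc_le_eq)
      then show ?thesis by simp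
    qed
    finally show ?thesis .
  qed
  show ?thesis
    by (intro exI[of _ "6 * C0"]) (use main C0 in auto)
qed

end
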